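(* For each $i\ge 0$, the map $$H_i(E_2(\mathbb{Z}[t]),\mathbb{Z})\to H_i(SL_2(\mathbb{Z}[t]),\mathbb{Z})$$ induced by the inclusion $E_2(\mathbb{Z}[t])\to SL_2(\mathbb{Z}[t])$ is nontrivial (i.e. not the zero map).
   Context: For a commutative ring $A$, $E_2(A)$ denotes the subgroup of $GL_2(A)$ generated by the elementary matrices. $H_i(-,\mathbb{Z})$ is integral group homology. *)

theory Defs
  imports
    "HOL-Analysis.Determinants"
    "HOL-Algebra.Free_Abelian_Groups"
    "HOL-Computational_Algebra.Polynomial"
begin

section \<open>Integral group homology via the bar complex\<close>

text \<open>
  The list \<open>[g\<^sub>1, \<dots>, g\<^sub>n]\<close> stands for the generator \<open>[g\<^sub>1 | \<dots> | g\<^sub>n]\<close> of the inhomogeneous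
  bar complex with trivial coefficients \<open>\<int>\<close>; its faces are
  \<open>[g\<^sub>2 | \<dots> | g\<^sub>n]\<close>, \<open>[g\<^sub>1 | \<dots> | g\<^sub>i g\<^bsub>i+1\<^esub> | \<dots> | g\<^sub>n]\<close> for \<open>0 < i < n\<close>, and \<open>[g\<^sub>1 | \<dots> | g\<^bsub>n-1\<^esub>]\<close>.
\<close>

definition bar_cells :: "('a, 'm) monoid_scheme \<Rightarrow> nat \<Rightarrow> 'a list set"
  where "bar_cells G n = {gs. length gs = n \<and> set gs \<subseteq> carrier G}"

definition bar_face :: "('a, 'm) monoid_scheme \<Rightarrow> nat \<Rightarrow> 'a list \<Rightarrow> 'a list"
  where "bar_face G i gs =
    (if i = 0 then tl gs
     else if i = length gs then butlast gs
     else take (i - 1) gs @ (gs ! (i - 1) \<otimes>\<^bsub>G\<^esub> gs ! i) # drop (Suc i) gs)"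

definition bar_chains :: "('a, 'm) monoid_scheme \<Rightarrow> nat \<Rightarrow> ('a list \<Rightarrow>\<^sub>0 int) monoid"
  where "bar_chains G n = free_Abelian_group (bar_cells G n)"

definition bar_boundary ::
    "('a, 'm) monoid_scheme \<Rightarrow> nat \<Rightarrow> ('a list \<Rightarrow>\<^sub>0 int) \<Rightarrow> ('a list \<Rightarrow>\<^sub>0 int)"
  where "bar_boundary G n c =
    (if n = 0 then 0
     else frag_extend (\<lambda>gs. \<Sum>i\<le>n. frag_cmul ((-1) ^ i) (frag_of (bar_face G i gs))) c)"

definition bar_cycles :: "('a, 'm) monoid_scheme \<Rightarrow> nat \<Rightarrow> ('a list \<Rightarrow>\<^sub>0 int) monoid"
  where "bar_cycles G n =
    (bar_chains G n)\<lparr>carrier := {c \<in> carrier (bar_chains G n). bar_boundary G n c = 0}\<rparr>"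

definition bar_boundaries :: "('a, 'm) monoid_scheme \<Rightarrow> nat \<Rightarrow> ('a list \<Rightarrow>\<^sub>0 int) set"
  where "bar_boundaries G n = bar_boundary G (Suc n) ` carrier (bar_chains G (Suc n))"

definition group_homology ::
    "nat \<Rightarrow> ('a, 'm) monoid_scheme \<Rightarrow> ('a list \<Rightarrow>\<^sub>0 int) set monoid"
  where "group_homology n G = bar_cycles G n Mod bar_boundaries G n"

definition bar_map :: "('a \<Rightarrow> 'b) \<Rightarrow> ('a list \<Rightarrow>\<^sub>0 int) \<Rightarrow> ('b list \<Rightarrow>\<^sub>0 int)"
  where "bar_map f = frag_extend (\<lambda>gs. frag_of (map f gs))"

text \<open>
  Homology classes are cosets of cycles.  For a homomorphism \<open>f\<close> from \<open>G\<close> to \<open>H\<close>, the class of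
  \<open>bar_map f z\<close> is the same for all cycles \<open>z\<close> in a given class, so \<open>the_elem\<close> is applied to a
  singleton; see \<open>group_homology_map_class\<close> below.
\<close>

definition group_homology_map ::
    "nat \<Rightarrow> ('a, 'm) monoid_scheme \<Rightarrow> ('b, 'k) monoid_scheme \<Rightarrow> ('a \<Rightarrow> 'b)
      \<Rightarrow> ('a list \<Rightarrow>\<^sub>0 int) set \<Rightarrow> ('b list \<Rightarrow>\<^sub>0 int) set"
  where "group_homology_map n G H f X =
    the_elem ((\<lambda>z. bar_boundaries H n #>\<^bsub>bar_cycles H n\<^esub> bar_map f z) ` X)"


subsection \<open>Well-definedness\<close>

lemma length_bar_face: "i \<le> length gs \<Longrightarrow> length (bar_face G i gs) = length gs - 1"
  by (auto simp: bar_face_def)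

lemma nth_bar_face:
  assumes "i \<le> length gs" "Suc k < length gs"
  shows "bar_face G i gs ! k =
    (if Suc k < i then gs ! k else if Suc k = i then gs ! k \<otimes>\<^bsub>G\<^esub> gs ! Suc k else gs ! Suc k)"
proof -
  consider "i = 0" | "i \<noteq> 0" "i = length gs" | "0 < i" "i < length gs"
    using assms by linarith
  then show ?thesis
  proof cases
    case 1
    then show ?thesis using assms by (simp add: bar_face_def nth_tl)
  next
    case 2
    then show ?thesis using assms by (auto simp: bar_face_def nth_butlast)
  next
    case 3
    have "k - (i - 1) = Suc (k - i)" if "i < Suc k"
      using 3 that by simp
    then show ?thesis using assms 3
      by (auto simp: bar_face_def nth_append)
  qed
qed

lemma bar_face_in_cells:
  assumes "monoid G" "gs \<in> bar_cells G (Suc n)" "i \<le> Suc n"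
  shows "bar_face G i gs \<in> bar_cells G n"
proof -
  interpret monoid G by fact
  have gs: "length gs = Suc n" "\<And>k. k < Suc n \<Longrightarrow> gs ! k \<in> carrier G"
    using assms(2) by (auto simp: bar_cells_def)
  have "bar_face G i gs ! k \<in> carrier G" if "k < n" for k
    using that gs assms(3) by (simp add: nth_bar_face)
  then show ?thesis
    using gs assms(3) by (auto simp: bar_cells_def length_bar_face in_set_conv_nth)
qed

lemma bar_face_face:
  assumes "monoid G" "gs \<in> bar_cells G (Suc (Suc n))" "i \<le> j" "j \<le> Suc n"
  shows "bar_face G i (bar_face G (Suc j) gs) = bar_face G j (bar_face G i gs)"
proof -
  interpret monoid G by fact
  have gs: "length gs = Suc (Suc n)" "\<And>k. k < Suc (Suc n) \<Longrightarrow> gs ! k \<in> carrier G"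
    using assms(2) by (auto simp: bar_cells_def)
  show ?thesis
  proof (rule nth_equalityI)
    show "length (bar_face G i (bar_face G (Suc j) gs)) = length (bar_face G j (bar_face G i gs))"
      using assms gs by (simp add: length_bar_face)
  next
    fix k
    assume "k < length (bar_face G i (bar_face G (Suc j) gs))"
    then have "k < n"
      using assms gs by (simp add: length_bar_face)
    then show "bar_face G i (bar_face G (Suc j) gs) ! k = bar_face G j (bar_face G i gs) ! k"
      using assms(3,4) gs by (auto simp: nth_bar_face length_bar_face m_assoc)
  qed
qed

lemma bar_boundary_0 [simp]: "bar_boundary G n 0 = 0"
  by (simp add: bar_boundary_def)

lemma bar_boundary_add: "bar_boundary G n (a + b) = bar_boundary G n a + bar_boundary G n b"
  by (simp add: bar_boundary_def frag_extend_add)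

lemma bar_boundary_diff: "bar_boundary G n (a - b) = bar_boundary G n a - bar_boundary G n b"
  by (simp add: bar_boundary_def frag_extend_diff)

lemma bar_boundary_cmul: "bar_boundary G n (frag_cmul k a) = frag_cmul k (bar_boundary G n a)"
  by (simp add: bar_boundary_def frag_extend_cmul)

lemma bar_boundary_sum: "bar_boundary G n (sum g I) = (\<Sum>i\<in>I. bar_boundary G n (g i))"
  by (induction I rule: infinite_finite_induct) (simp_all add: bar_boundary_add)

lemma bar_boundary_of:
  "bar_boundary G (Suc n) (frag_of gs) =
    (\<Sum>i\<le>Suc n. frag_cmul ((-1) ^ i) (frag_of (bar_face G i gs)))"
  by (simp add: bar_boundary_def)

lemma carrier_bar_chains [simp]:
  "carrier (bar_chains G n) = {c. Poly_Mapping.keys c \<subseteq> bar_cells G n}"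
  by (auto simp: bar_chains_def)

lemma bar_boundary_in_chains:
  assumes "monoid G" "c \<in> carrier (bar_chains G (Suc n))"
  shows "bar_boundary G (Suc n) c \<in> carrier (bar_chains G n)"
proof -
  have "Poly_Mapping.keys c \<subseteq> bar_cells G (Suc n)"
    using assms by simp
  then show ?thesis
  proof (induction rule: frag_induction)
    case (one gs)
    have "Poly_Mapping.keys (frag_cmul ((-1) ^ i) (frag_of (bar_face G i gs))) \<subseteq> bar_cells G n"
      if "i \<le> Suc n" for i
      by (rule order_trans[OF keys_cmul]) (use bar_face_in_cells[OF assms(1) one that] in simp)
    then show ?case
      unfolding bar_boundary_of carrier_bar_chains mem_Collect_eq
      by (intro order_trans[OF keys_sum] UN_least) simp
  next
    case (diff a b)
    then show ?case
      using keys_diff[of "bar_boundary G (Suc n) a" "bar_boundary G (Suc n) b"]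
      by (auto simp: bar_boundary_diff)
  qed auto
qed

lemma bar_boundary_boundary:
  assumes "monoid G" "c \<in> carrier (bar_chains G (Suc n))"
  shows "bar_boundary G n (bar_boundary G (Suc n) c) = 0"
proof (cases n)
  case 0
  then show ?thesis by (simp add: bar_boundary_def)
next
  case (Suc m)
  have "Poly_Mapping.keys c \<subseteq> bar_cells G (Suc n)"
    using assms by simp
  then show ?thesis
  proof (induction rule: frag_induction)
    case (one gs)
    define p where "p = Suc n"
    have p: "p - Suc 0 = Suc m" "p = Suc (Suc m)"
      by (auto simp: p_def Suc)
    have eql: "{..p} \<times> {..p - Suc 0} \<inter> {(x, y). y < x}
        = (\<lambda>(j,i). (Suc i, j)) ` {(i,j). i \<le> j \<and> j \<le> p - 1}"
      using p by (auto simp: image_def) (metis Suc_le_mono less_Suc_eq_le not0_implies_Suc not_less0)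
    have eqr: "{..p} \<times> {..p - Suc 0} - {(x, y). y < x} = {(i,j). i \<le> j \<and> j \<le> p - 1}"
      by auto
    have eqf: "bar_face G i (bar_face G (Suc j) gs) = bar_face G j (bar_face G i gs)"
      if "i \<le> j" "j \<le> p - Suc 0" for i j
      using bar_face_face[OF assms(1), of gs m i j] that one p Suc by simp
    have eq0: "frag_cmul (-1) a = b \<Longrightarrow> a + b = 0" for a b :: "'a list \<Rightarrow>\<^sub>0 int"
      by (simp add: neg_eq_iff_add_eq_0)
    have *: "(\<Sum>x\<le>p. \<Sum>i\<le>p - Suc 0.
        frag_cmul ((-1) ^ (x + i)) (frag_of (bar_face G i (bar_face G x gs)))) = 0"
      apply (simp add: sum.cartesian_product sum.Int_Diff [of "_ \<times> _" _ "{(x,y). y < x}"])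
      apply (rule eq0)
      unfolding frag_cmul_sum prod.case_distrib [of "frag_cmul (-1)"] frag_cmul_cmul eql eqr
      apply (force simp: inj_on_def sum.reindex add.commute eqf intro: sum.cong)
      done
    have "bar_boundary G n (bar_boundary G (Suc n) (frag_of gs))
      = (\<Sum>x\<le>p. \<Sum>i\<le>p - Suc 0.
        frag_cmul ((-1) ^ (x + i)) (frag_of (bar_face G i (bar_face G x gs))))"
      unfolding p Suc bar_boundary_of bar_boundary_sum bar_boundary_cmul frag_cmul_sum
        frag_cmul_cmul power_add diff_Suc_1' ..
    then show ?case using * by simp
  next
    case (diff a b)
    then show ?case by (simp add: bar_boundary_diff)
  qed simp
qed

lemma carrier_bar_cycles [simp]:
  "carrier (bar_cycles G n) =
    {c. Poly_Mapping.keys c \<subseteq> bar_cells G n \<and> bar_boundary G n c = 0}"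
  by (auto simp: bar_cycles_def)

lemma mult_bar_cycles [simp]: "a \<otimes>\<^bsub>bar_cycles G n\<^esub> b = a + b"
  by (simp add: bar_cycles_def bar_chains_def)

lemma one_bar_cycles [simp]: "\<one>\<^bsub>bar_cycles G n\<^esub> = 0"
  by (simp add: bar_cycles_def bar_chains_def)

lemma comm_group_bar_cycles: "comm_group (bar_cycles G n)"
proof (rule comm_groupI)
  fix x y
  assume "x \<in> carrier (bar_cycles G n)" "y \<in> carrier (bar_cycles G n)"
  then show "x \<otimes>\<^bsub>bar_cycles G n\<^esub> y \<in> carrier (bar_cycles G n)"
    using keys_add[of x y] by (auto simp: bar_boundary_add)
next
  fix x
  assume "x \<in> carrier (bar_cycles G n)"
  then show "\<exists>y\<in>carrier (bar_cycles G n). y \<otimes>\<^bsub>bar_cycles G n\<^esub> x = \<one>\<^bsub>bar_cycles G n\<^esub>"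
    using bar_boundary_diff[of G n 0 x] by (intro bexI[of _ "- x"]) auto
qed (auto simp: add_ac)

lemma bar_boundaries_subset:
  assumes "monoid G"
  shows "bar_boundaries G n \<subseteq> carrier (bar_cycles G n)"
  using bar_boundary_in_chains[OF assms] bar_boundary_boundary[OF assms]
  by (auto simp: bar_boundaries_def)

lemma subgroup_bar_boundaries:
  assumes "monoid G"
  shows "subgroup (bar_boundaries G n) (bar_cycles G n)"
proof -
  interpret Z: comm_group "bar_cycles G n" by (rule comm_group_bar_cycles)
  have diff: "x - y \<in> bar_boundaries G n" if "x \<in> bar_boundaries G n" "y \<in> bar_boundaries G n" for x y
  proof -
    from that obtain a b where
      ab: "a \<in> carrier (bar_chains G (Suc n))" "b \<in> carrier (bar_chains G (Suc n))"
      and xy: "x = bar_boundary G (Suc n) a" "y = bar_boundary G (Suc n) b"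
      by (auto simp: bar_boundaries_def)
    have "x - y = bar_boundary G (Suc n) (a - b)"
      by (simp add: xy bar_boundary_diff)
    moreover have "a - b \<in> carrier (bar_chains G (Suc n))"
      using ab keys_diff[of a b] by auto
    ultimately show ?thesis by (auto simp: bar_boundaries_def)
  qed
  have zero: "0 \<in> bar_boundaries G n"
    unfolding bar_boundaries_def by (rule image_eqI[of _ _ 0]) auto
  have inv: "inv\<^bsub>bar_cycles G n\<^esub> x = - x" if "x \<in> carrier (bar_cycles G n)" for x
    using that bar_boundary_diff[of G n 0 x] by (intro Z.inv_equality) auto
  show ?thesis
  proof (rule Z.subgroupI)
    show "bar_boundaries G n \<subseteq> carrier (bar_cycles G n)"
      by (rule bar_boundaries_subset[OF assms])
    show "bar_boundaries G n \<noteq> {}"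
      using zero by blast
  next
    fix a assume a: "a \<in> bar_boundaries G n"
    then have "inv\<^bsub>bar_cycles G n\<^esub> a = - a"
      using inv bar_boundaries_subset[OF assms] by blast
    then show "inv\<^bsub>bar_cycles G n\<^esub> a \<in> bar_boundaries G n"
      using diff[OF zero a] by simp
  next
    fix a b assume a: "a \<in> bar_boundaries G n" and b: "b \<in> bar_boundaries G n"
    show "a \<otimes>\<^bsub>bar_cycles G n\<^esub> b \<in> bar_boundaries G n"
      using diff[OF a diff[OF zero b]] by simp
  qed
qed

lemma normal_bar_boundaries:
  assumes "monoid G"
  shows "bar_boundaries G n \<lhd> bar_cycles G n"
  using comm_group.normal_iff_subgroup[OF comm_group_bar_cycles] subgroup_bar_boundaries[OF assms]
  by blast

lemma comm_group_group_homology: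
  assumes "monoid G"
  shows "comm_group (group_homology n G)"
  unfolding group_homology_def
  using comm_group.abelian_FactGroup[OF comm_group_bar_cycles subgroup_bar_boundaries[OF assms]] .

lemma bar_map_add: "bar_map f (a + b) = bar_map f a + bar_map f b"
  by (simp add: bar_map_def frag_extend_add)

lemma bar_map_diff: "bar_map f (a - b) = bar_map f a - bar_map f b"
  by (simp add: bar_map_def frag_extend_diff)

lemma bar_map_cmul: "bar_map f (frag_cmul k a) = frag_cmul k (bar_map f a)"
  by (simp add: bar_map_def frag_extend_cmul)

lemma bar_map_0 [simp]: "bar_map f 0 = 0"
  by (simp add: bar_map_def)

lemma bar_map_sum: "bar_map f (sum g I) = (\<Sum>i\<in>I. bar_map f (g i))"
  by (induction I rule: infinite_finite_induct) (simp_all add: bar_map_add)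

lemma bar_map_of [simp]: "bar_map f (frag_of gs) = frag_of (map f gs)"
  by (simp add: bar_map_def)

lemma map_in_bar_cells: "f \<in> hom G H \<Longrightarrow> gs \<in> bar_cells G n \<Longrightarrow> map f gs \<in> bar_cells H n"
  by (auto simp: bar_cells_def hom_def)

lemma bar_map_in_chains:
  assumes "f \<in> hom G H" "Poly_Mapping.keys c \<subseteq> bar_cells G n"
  shows "Poly_Mapping.keys (bar_map f c) \<subseteq> bar_cells H n"
  using assms(2)
proof (induction rule: frag_induction)
  case (one gs)
  then show ?case using map_in_bar_cells[OF assms(1)] by simp
next
  case (diff a b)
  then show ?case using keys_diff[of "bar_map f a" "bar_map f b"] by (auto simp: bar_map_diff)
qed simp

lemma bar_face_map:
  assumes "f \<in> hom G H" "gs \<in> bar_cells G n" "i \<le> n"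
  shows "bar_face H i (map f gs) = map f (bar_face G i gs)"
proof -
  have gs: "length gs = n" "\<And>k. k < n \<Longrightarrow> gs ! k \<in> carrier G"
    using assms(2) by (auto simp: bar_cells_def)
  show ?thesis
    using assms(1,3) gs
    by (intro nth_equalityI) (auto simp: length_bar_face nth_bar_face hom_mult)
qed

lemma bar_boundary_map:
  assumes "f \<in> hom G H" "Poly_Mapping.keys c \<subseteq> bar_cells G n"
  shows "bar_boundary H n (bar_map f c) = bar_map f (bar_boundary G n c)"
  using assms(2)
proof (induction rule: frag_induction)
  case (one gs)
  then show ?case
    using bar_face_map[OF assms(1) one]
    by (simp add: bar_boundary_def bar_map_sum bar_map_cmul)
next
  case (diff a b)
  then show ?case by (simp add: bar_map_diff bar_boundary_diff)
qed simp

lemma bar_map_in_cycles: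
  assumes "f \<in> hom G H" "z \<in> carrier (bar_cycles G n)"
  shows "bar_map f z \<in> carrier (bar_cycles H n)"
  using assms bar_map_in_chains[OF assms(1)] bar_boundary_map[OF assms(1), of z n] by simp

lemma bar_map_in_boundaries:
  assumes "f \<in> hom G H" "b \<in> bar_boundaries G n"
  shows "bar_map f b \<in> bar_boundaries H n"
proof -
  obtain c where c: "c \<in> carrier (bar_chains G (Suc n))" "b = bar_boundary G (Suc n) c"
    using assms(2) by (auto simp: bar_boundaries_def)
  then have "bar_map f b = bar_boundary H (Suc n) (bar_map f c)"
    using bar_boundary_map[OF assms(1)] by simp
  then show ?thesis
    using c bar_map_in_chains[OF assms(1), of c "Suc n"] by (auto simp: bar_boundaries_def)
qed

lemma group_homology_map_class:
  assumes "monoid G" "monoid H" "f \<in> hom G H" "z \<in> carrier (bar_cycles G n)"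
  shows "group_homology_map n G H f (bar_boundaries G n #>\<^bsub>bar_cycles G n\<^esub> z)
    = bar_boundaries H n #>\<^bsub>bar_cycles H n\<^esub> bar_map f z"
proof -
  interpret Z: comm_group "bar_cycles H n" by (rule comm_group_bar_cycles)
  have sub: "subgroup (bar_boundaries H n) (bar_cycles H n)"
    by (rule subgroup_bar_boundaries[OF assms(2)])
  have zH: "bar_map f z \<in> carrier (bar_cycles H n)"
    by (rule bar_map_in_cycles[OF assms(3,4)])
  have eq: "bar_boundaries H n #>\<^bsub>bar_cycles H n\<^esub> bar_map f w
      = bar_boundaries H n #>\<^bsub>bar_cycles H n\<^esub> bar_map f z"
    if "w \<in> bar_boundaries G n #>\<^bsub>bar_cycles G n\<^esub> z" for w
  proof -
    from that obtain b where b: "b \<in> bar_boundaries G n" "w = b + z"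
      by (auto simp: r_coset_def)
    have "bar_map f w \<in> bar_boundaries H n #>\<^bsub>bar_cycles H n\<^esub> bar_map f z"
      using bar_map_in_boundaries[OF assms(3) b(1)] b(2)
      by (auto simp: r_coset_def bar_map_add)
    from Z.repr_independence[OF this zH sub] show ?thesis by simp
  qed
  have "0 \<in> bar_boundaries G n"
    unfolding bar_boundaries_def by (rule image_eqI[of _ _ 0]) auto
  then have "z \<in> bar_boundaries G n #>\<^bsub>bar_cycles G n\<^esub> z"
    by (force simp: r_coset_def)
  then have "(\<lambda>w. bar_boundaries H n #>\<^bsub>bar_cycles H n\<^esub> bar_map f w)
      ` (bar_boundaries G n #>\<^bsub>bar_cycles G n\<^esub> z)
      = {bar_boundaries H n #>\<^bsub>bar_cycles H n\<^esub> bar_map f z}"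
    using eq by blast
  then show ?thesis
    by (simp add: group_homology_map_def)
qed

lemma group_homology_map_hom:
  assumes "monoid G" "monoid H" "f \<in> hom G H"
  shows "group_homology_map n G H f \<in> hom (group_homology n G) (group_homology n H)"
proof (rule homI)
  interpret NG: normal "bar_boundaries G n" "bar_cycles G n"
    by (rule normal_bar_boundaries[OF assms(1)])
  interpret NH: normal "bar_boundaries H n" "bar_cycles H n"
    by (rule normal_bar_boundaries[OF assms(2)])
  {
    fix X assume "X \<in> carrier (group_homology n G)"
    then obtain z where "z \<in> carrier (bar_cycles G n)"
      "X = bar_boundaries G n #>\<^bsub>bar_cycles G n\<^esub> z"
      by (auto simp: group_homology_def carrier_FactGroup)
    then show "group_homology_map n G H f X \<in> carrier (group_homology n H)"
      using bar_map_in_cycles[OF assms(3)] group_homology_map_class[OF assms]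
      by (auto simp: group_homology_def carrier_FactGroup simp del: carrier_bar_cycles)
  }
  fix X Y assume "X \<in> carrier (group_homology n G)" "Y \<in> carrier (group_homology n G)"
  then obtain z w where
    z: "z \<in> carrier (bar_cycles G n)" "X = bar_boundaries G n #>\<^bsub>bar_cycles G n\<^esub> z" and
    w: "w \<in> carrier (bar_cycles G n)" "Y = bar_boundaries G n #>\<^bsub>bar_cycles G n\<^esub> w"
    by (auto simp: group_homology_def carrier_FactGroup simp del: carrier_bar_cycles)
  have "X \<otimes>\<^bsub>group_homology n G\<^esub> Y = bar_boundaries G n #>\<^bsub>bar_cycles G n\<^esub> (z + w)"
    using NG.rcos_sum[OF z(1) w(1)] z w by (simp add: group_homology_def)
  moreover have "z + w \<in> carrier (bar_cycles G n)"
    using NG.m_closed[OF z(1) w(1)] by (simp only: mult_bar_cycles)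
  moreover have "group_homology_map n G H f X \<otimes>\<^bsub>group_homology n H\<^esub> group_homology_map n G H f Y
      = bar_boundaries H n #>\<^bsub>bar_cycles H n\<^esub> (bar_map f z + bar_map f w)"
    using NH.rcos_sum[OF bar_map_in_cycles[OF assms(3) z(1)] bar_map_in_cycles[OF assms(3) w(1)]]
      group_homology_map_class[OF assms z(1)] group_homology_map_class[OF assms w(1)] z w
    by (simp add: group_homology_def)
  ultimately show "group_homology_map n G H f (X \<otimes>\<^bsub>group_homology n G\<^esub> Y)
      = group_homology_map n G H f X \<otimes>\<^bsub>group_homology n H\<^esub> group_homology_map n G H f Y"
    using group_homology_map_class[OF assms] by (simp only: bar_map_add)
qed


section \<open>The groups \<open>GL\<^sub>2\<close>, \<open>SL\<^sub>2\<close> and \<open>E\<^sub>2\<close> of a commutative ring\<close>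

definition GL2 :: "('a::comm_ring_1 ^ 2 ^ 2) monoid"
  where "GL2 = \<lparr>carrier = {A. invertible A}, mult = (**), one = mat 1\<rparr>"

definition SL2 :: "('a::comm_ring_1 ^ 2 ^ 2) monoid"
  where "SL2 = GL2\<lparr>carrier := {A \<in> carrier GL2. det A = 1}\<rparr>"

definition elementary_matrix :: "2 \<Rightarrow> 2 \<Rightarrow> 'a::comm_ring_1 \<Rightarrow> 'a ^ 2 ^ 2"
  where "elementary_matrix i j a = (\<chi> k l. (if k = l then 1 else 0) + (if k = i \<and> l = j then a else 0))"

definition E2 :: "('a::comm_ring_1 ^ 2 ^ 2) monoid"
  where "E2 = subgroup_generated GL2 {elementary_matrix i j a | i j a. i \<noteq> j}"

lemma group_GL2: "group GL2"
proof (rule groupI)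
  fix A B :: "'a ^ 2 ^ 2"
  assume "A \<in> carrier GL2" "B \<in> carrier GL2"
  then show "A \<otimes>\<^bsub>GL2\<^esub> B \<in> carrier GL2"
    by (auto simp: GL2_def invertible_mult)
next
  fix A :: "'a ^ 2 ^ 2"
  assume "A \<in> carrier GL2"
  then show "\<exists>B\<in>carrier GL2. B \<otimes>\<^bsub>GL2\<^esub> A = \<one>\<^bsub>GL2\<^esub>"
    by (auto simp: GL2_def invertible_def)
qed (auto simp: GL2_def matrix_mul_assoc invertible_def)

lemma subgroup_SL2: "subgroup (carrier SL2) GL2"
proof -
  interpret group "GL2 :: ('a ^ 2 ^ 2) monoid" by (rule group_GL2)
  have det_mult: "det (A \<otimes>\<^bsub>GL2\<^esub> B) = det A * det B" for A B :: "'a ^ 2 ^ 2"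
    by (simp add: GL2_def det_mul)
  have det_one: "det \<one>\<^bsub>GL2\<^esub> = (1::'a)"
    by (simp add: GL2_def)
  show ?thesis
  proof (rule subgroupI)
    show "carrier SL2 \<subseteq> carrier (GL2 :: ('a ^ 2 ^ 2) monoid)"
      by (auto simp: SL2_def)
    show "carrier (SL2 :: ('a ^ 2 ^ 2) monoid) \<noteq> {}"
      using det_one one_closed by (auto simp: SL2_def)
  next
    fix A :: "'a ^ 2 ^ 2" assume "A \<in> carrier SL2"
    then have A: "A \<in> carrier GL2" "det A = 1" by (auto simp: SL2_def)
    then show "inv\<^bsub>GL2\<^esub> A \<in> carrier SL2"
      using det_mult[of A "inv\<^bsub>GL2\<^esub> A"] det_one by (simp add: SL2_def)
  next
    fix A B :: "'a ^ 2 ^ 2" assume "A \<in> carrier SL2" "B \<in> carrier SL2"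
    then show "A \<otimes>\<^bsub>GL2\<^esub> B \<in> carrier SL2"
      by (auto simp: SL2_def det_mult)
  qed
qed

lemma group_SL2: "group SL2"
  using subgroup.subgroup_is_group[OF subgroup_SL2 group_GL2] by (simp add: SL2_def)

lemma group_E2: "group E2"
  unfolding E2_def by (rule group.group_subgroup_generated[OF group_GL2])

lemma elementary_matrix_mult:
  "i \<noteq> j \<Longrightarrow> elementary_matrix i j a ** elementary_matrix i j b = elementary_matrix i j (a + b)"
  using exhaust_2[of i] exhaust_2[of j]
  by (auto simp: elementary_matrix_def matrix_matrix_mult_def vec_eq_iff sum_2 forall_2)

lemma elementary_matrix_in_SL2:
  assumes "i \<noteq> j"
  shows "elementary_matrix i j a \<in> carrier SL2"
proof -
  have "elementary_matrix i j 0 = (mat 1 :: 'a ^ 2 ^ 2)"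
    by (simp add: elementary_matrix_def mat_def vec_eq_iff)
  then have "invertible (elementary_matrix i j a)"
    unfolding invertible_def using elementary_matrix_mult[OF assms, of a "- a"]
      elementary_matrix_mult[OF assms, of "- a" a] by auto
  moreover have "det (elementary_matrix i j a) = 1"
    using assms exhaust_2[of i] exhaust_2[of j] by (auto simp: det_2 elementary_matrix_def)
  ultimately show ?thesis by (simp add: SL2_def GL2_def)
qed

lemma id_hom_E2_SL2: "id \<in> hom E2 SL2"
proof -
  interpret group "GL2 :: ('a ^ 2 ^ 2) monoid" by (rule group_GL2)
  have "carrier (E2 :: ('a ^ 2 ^ 2) monoid) \<subseteq> carrier SL2"
    unfolding E2_def carrier_subgroup_generated
    by (rule generate_subgroup_incl[OF _ subgroup_SL2]) (use elementary_matrix_in_SL2 in auto)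
  then show ?thesis
    by (auto simp: hom_def SL2_def E2_def)
qed

end

theory Submission
  imports Defs "HOL-Library.Z2"
begin

text \<open>
  The group \<open>SL\<^sub>2(\<F>\<^sub>2[t])\<close> is the amalgam of \<open>SL\<^sub>2(\<F>\<^sub>2)\<close> and the upper unipotent group \<open>\<F>\<^sub>2[t]\<close>
  over \<open>\<F>\<^sub>2\<close> (Nagao), so it maps onto \<open>\<F>\<^sub>2[t]/\<F>\<^sub>2\<close> by killing \<open>SL\<^sub>2(\<F>\<^sub>2)\<close>. Concretely, this map sends a
  matrix to the sum of the quotients of the Euclidean algorithm run on its first column, corrected
  by a term from the second column; reading off coefficients gives homomorphisms
  \<open>\<phi>\<^sub>0, \<phi>\<^sub>1, \<dots>\<close> from \<open>SL\<^sub>2(\<int>[t])\<close> to \<open>\<F>\<^sub>2\<close> that are dual to the commuting elementary matrices \<open>x\<^sub>k\<close> with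
  entry \<open>t\<^bsup>k+1\<^esup>\<close>. The cup product of the first \<open>i\<close> of these homomorphisms is a cocycle which takes
  the value \<open>1\<close> on the cycle \<open>\<Sum>\<^sub>\<sigma> sign(\<sigma>) [x\<^bsub>\<sigma>(0)\<^esub> | \<dots> | x\<^bsub>\<sigma>(i-1)\<^esub>]\<close>. This cycle lives on
  \<open>E\<^sub>2(\<int>[t])\<close>, and its image is therefore not a boundary on \<open>SL\<^sub>2(\<int>[t])\<close>.
\<close>

section \<open>Cup products of homomorphisms\<close>

text \<open>The Kronecker pairing of cochains with integral chains; a general coefficient ring
  allows values in F_2.\<close>

definition frag_eval :: "('a \<Rightarrow> 'r::comm_ring_1) \<Rightarrow> ('a \<Rightarrow>\<^sub>0 int) \<Rightarrow> 'r"
  where "frag_eval f c = (\<Sum>x\<in>Poly_Mapping.keys c. of_int (poly_mapping.lookup c x) * f x)"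

lemma frag_eval_superset:
  assumes "finite S" "Poly_Mapping.keys c \<subseteq> S"
  shows "frag_eval f c = (\<Sum>x\<in>S. of_int (poly_mapping.lookup c x) * f x)"
  unfolding frag_eval_def
  by (rule sum.mono_neutral_left) (use assms in \<open>auto simp: in_keys_iff\<close>)

lemma frag_eval_0 [simp]: "frag_eval f 0 = 0"
  by (simp add: frag_eval_def)

lemma frag_eval_of [simp]: "frag_eval f (frag_of x) = f x"
  by (simp add: frag_eval_def)

lemma frag_eval_add: "frag_eval f (a + b) = frag_eval f a + frag_eval f b"
proof -
  let ?S = "Poly_Mapping.keys a \<union> Poly_Mapping.keys b"
  have "Poly_Mapping.keys (a + b) \<subseteq> ?S" by (rule keys_add)
  then show ?thesis
    by (simp add: frag_eval_superset[of ?S] lookup_add distrib_right sum.distrib)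
qed

lemma frag_eval_cmul: "frag_eval f (frag_cmul k a) = of_int k * frag_eval f a"
  using frag_eval_superset[OF _ keys_cmul, of a f k]
  by (simp add: frag_eval_def sum_distrib_left mult.assoc)

lemma frag_eval_diff: "frag_eval f (a - b) = frag_eval f a - frag_eval f b"
  using frag_eval_add[of f "a - b" b] by (simp add: algebra_simps)

lemma frag_eval_sum: "frag_eval f (sum g I) = (\<Sum>i\<in>I. frag_eval f (g i))"
  by (induction I rule: infinite_finite_induct) (simp_all add: frag_eval_add)

text \<open>In inhomogeneous bar coordinates this is the cup product of 1-cocycles; in degree 0 the
  empty product gives the augmentation.\<close>

definition cup_hom :: "(nat \<Rightarrow> 'a \<Rightarrow> 'r::comm_ring_1) \<Rightarrow> 'a list \<Rightarrow> 'r"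
  where "cup_hom \<phi> gs = (\<Prod>j<length gs. \<phi> j (gs ! j))"

lemma alternating_telescope:
  fixes T :: "nat \<Rightarrow> 'r::comm_ring_1"
  shows "(\<Sum>i\<le>n. (-1) ^ i * ((if i = 0 then 0 else T (i - 1)) + T i)) = (-1) ^ n * T n"
  by (induction n) (simp_all add: algebra_simps)

text \<open>\<open>T k\<close> is the product over \<open>gs\<close> with entry \<open>k\<close>
  omitted. An inner face merges two neighbours, and additivity in the merged slot keeps one of them
  at a time; an outer face simply drops an entry.\<close>

lemma cup_hom_face:
  fixes \<phi> :: "nat \<Rightarrow> 'a \<Rightarrow> 'r::comm_ring_1"
  assumes hom: "\<And>j g h. g \<in> carrier G \<Longrightarrow> h \<in> carrier G \<Longrightarrow> \<phi> j (g \<otimes>\<^bsub>G\<^esub> h) = \<phi> j g + \<phi> j h"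
    and gs: "gs \<in> bar_cells G (Suc n)" and i: "i \<le> Suc n"
  defines "T \<equiv> \<lambda>k. (\<Prod>j<n. \<phi> j (gs ! (if j < k then j else Suc j)))"
  shows "cup_hom \<phi> (bar_face G i gs) =
    (if i = 0 then 0 else T (i - 1)) + (if i = Suc n then 0 else T i)"
proof -
  have len: "length gs = Suc n" and mem: "\<And>k. k < Suc n \<Longrightarrow> gs ! k \<in> carrier G"
    using gs by (auto simp: bar_cells_def)
  have face: "cup_hom \<phi> (bar_face G i gs) = (\<Prod>j<n. \<phi> j (bar_face G i gs ! j))"
    using i len by (simp add: cup_hom_def length_bar_face)
  consider "i = 0" | "i = Suc n" | k where "i = Suc k" "k < n"
    using i by (cases i) (auto simp: le_less)
  then show ?thesis
  proof cases
    case 1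
    then show ?thesis
      unfolding face using len by (auto simp: T_def nth_bar_face intro!: prod.cong)
  next
    case 2
    then show ?thesis
      unfolding face using len by (auto simp: T_def nth_bar_face intro!: prod.cong)
  next
    case 3
    let ?P = "\<lambda>F. (\<Prod>j\<in>{..<n} - {k}. F j)"
    let ?f = "\<lambda>j. \<phi> j (gs ! (if j < k then j else Suc j))"
    have split: "(\<Prod>j<n. F j) = F k * ?P F" for F :: "nat \<Rightarrow> 'r"
      using 3 by (intro prod.remove) auto
    have "cup_hom \<phi> (bar_face G i gs) = \<phi> k (gs ! k \<otimes>\<^bsub>G\<^esub> gs ! Suc k) * ?P ?f"
      unfolding face split using 3 len
      by (auto simp: nth_bar_face intro!: arg_cong2[where f = "(*)"] prod.cong split: if_splits)
    also have "\<dots> = \<phi> k (gs ! Suc k) * ?P ?f + \<phi> k (gs ! k) * ?P ?f"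
      using 3 mem by (simp add: hom algebra_simps)
    also have "\<phi> k (gs ! Suc k) * ?P ?f = T k"
      unfolding T_def split by simp
    also have "\<phi> k (gs ! k) * ?P ?f = T (Suc k)"
      unfolding T_def split
      by (auto intro!: arg_cong2[where f = "(*)"] prod.cong split: if_splits)
    finally show ?thesis using 3 by simp
  qed
qed

lemma frag_eval_cup_hom_boundaries:
  fixes \<phi> :: "nat \<Rightarrow> 'a \<Rightarrow> 'r::comm_ring_1"
  assumes hom: "\<And>j g h. g \<in> carrier G \<Longrightarrow> h \<in> carrier G \<Longrightarrow> \<phi> j (g \<otimes>\<^bsub>G\<^esub> h) = \<phi> j g + \<phi> j h"
    and b: "b \<in> bar_boundaries G n"
  shows "frag_eval (cup_hom \<phi>) b = 0"
proof -
  obtain c where c: "Poly_Mapping.keys c \<subseteq> bar_cells G (Suc n)" "b = bar_boundary G (Suc n) c"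
    using b by (auto simp: bar_boundaries_def)
  from c(1) have "frag_eval (cup_hom \<phi>) (bar_boundary G (Suc n) c) = 0"
  proof (induction rule: frag_induction)
    case (one gs)
    define T where "T = (\<lambda>k. (\<Prod>j<n. \<phi> j (gs ! (if j < k then j else Suc j))))"
    have "frag_eval (cup_hom \<phi>) (bar_boundary G (Suc n) (frag_of gs)) =
      (\<Sum>i\<le>Suc n. (-1) ^ i * ((if i = 0 then 0 else T (i - 1)) + (if i = Suc n then 0 else T i)))"
      unfolding bar_boundary_of frag_eval_sum frag_eval_cmul frag_eval_of
      by (intro sum.cong refl) (simp add: cup_hom_face[OF hom one] T_def)
    \<comment> \<open>The last face has only the term \<open>T n\<close>, which cancels what the
      telescope leaves.\<close>
    also have "\<dots> = (\<Sum>i\<le>n. (-1) ^ i * ((if i = 0 then 0 else T (i - 1)) + T i)) + (-1) ^ Suc n * T n"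
      by simp
    also have "\<dots> = 0"
      unfolding alternating_telescope by simp
    finally show ?case .
  next
    case (diff a b)
    then show ?case by (simp add: bar_boundary_diff frag_eval_diff)
  qed simp
  then show ?thesis using c by simp
qed


section \<open>The product cycle of commuting elements\<close>

text \<open>For commuting \<open>x k\<close> this is the shuffle product of the 1-cycles
  \<open>[x k]\<close>, the image of the fundamental class of the n-torus.\<close>

definition alternating_chain :: "nat \<Rightarrow> (nat \<Rightarrow> 'a) \<Rightarrow> ('a list \<Rightarrow>\<^sub>0 int)"
  where "alternating_chain n x =
    (\<Sum>\<sigma> | \<sigma> permutes {..<n}. frag_cmul (sign \<sigma>) (frag_of (map (x \<circ> \<sigma>) [0..<n])))"

lemma keys_alternating_chain:
  assumes "\<And>k. k < n \<Longrightarrow> x k \<in> carrier G"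
  shows "Poly_Mapping.keys (alternating_chain n x) \<subseteq> bar_cells G n"
proof -
  have "Poly_Mapping.keys (frag_cmul (sign \<sigma>) (frag_of (map (x \<circ> \<sigma>) [0..<n]))) \<subseteq> bar_cells G n"
    if "\<sigma> permutes {..<n}" for \<sigma>
  proof -
    have "\<sigma> k < n" if "k < n" for k
      using permutes_in_image[OF \<open>\<sigma> permutes {..<n}\<close>, of k] that by simp
    then show ?thesis
      using assms by (intro order_trans[OF keys_cmul]) (auto simp: bar_cells_def)
  qed
  then show ?thesis
    unfolding alternating_chain_def by (intro order_trans[OF keys_sum] UN_least) auto
qed

text \<open>This rotation later identifies the last face of one summand with the zeroth face of
  another; its sign makes the two cancel.\<close>

lemma cyclic_permutation_exists:
  "\<exists>\<rho>. \<rho> permutes {..<Suc m} \<and> sign \<rho> = (-1) ^ m \<and> (\<forall>k<m. \<rho> k = Suc k) \<and> \<rho> m = 0"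
proof (induction m)
  case 0
  then show ?case by (intro exI[of _ id] conjI permutes_id) auto
next
  case (Suc m)
  then obtain \<rho> where \<rho>: "\<rho> permutes {..<Suc m}" "sign \<rho> = (-1) ^ m" "\<forall>k<m. \<rho> k = Suc k" "\<rho> m = 0"
    by blast
  let ?t = "Transposition.transpose 0 (Suc m)"
  have t: "?t permutes {..<Suc (Suc m)}"
    by (rule permutes_swap_id) auto
  have \<rho>': "\<rho> permutes {..<Suc (Suc m)}"
    by (rule permutes_subset[OF \<rho>(1)]) auto
  have "sign (?t \<circ> \<rho>) = sign ?t * sign \<rho>"
    using t \<rho>' by (intro sign_compose) (auto simp: permutation_permutes)
  moreover have "sign ?t = -1" by (simp add: sign_swap_id)
  moreover have "\<rho> (Suc m) = Suc m"
    using permutes_not_in[OF \<rho>(1), of "Suc m"] by simp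
  ultimately have "sign (?t \<circ> \<rho>) = (-1) ^ Suc m"
    "\<forall>k<Suc m. (?t \<circ> \<rho>) k = Suc k" "(?t \<circ> \<rho>) (Suc m) = 0"
    using \<rho>(2-4) by (auto simp: less_Suc_eq)
  with permutes_compose[OF \<rho>' t] show ?case by blast
qed

lemma sum_sign_compose:
  fixes F :: "('a \<Rightarrow> 'a) \<Rightarrow> ('b \<Rightarrow>\<^sub>0 int)"
  assumes "finite S" "\<tau> permutes S"
  shows "(\<Sum>\<sigma> | \<sigma> permutes S. frag_cmul (sign \<sigma>) (F \<sigma>)) =
    frag_cmul (sign \<tau>) (\<Sum>\<sigma> | \<sigma> permutes S. frag_cmul (sign \<sigma>) (F (\<sigma> \<circ> \<tau>)))"
proof -
  have "sign (\<sigma> \<circ> \<tau>) = sign \<tau> * sign \<sigma>" if "\<sigma> permutes S" for \<sigma>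
    using that assms by (subst sign_compose) (auto simp: permutation_permutes)
  then show ?thesis
    by (subst sum_permutations_compose_right[OF assms(2)])
      (auto simp: frag_cmul_sum frag_cmul_cmul intro!: sum.cong)
qed

text \<open>Swapping the two merged entries preserves an inner face and flips the sign of the
  permutation, so each inner sum equals its own negative. The two outer sums cancel after a
  rotation.\<close>

lemma bar_boundary_alternating_chain:
  assumes comm: "\<And>j k. j < n \<Longrightarrow> k < n \<Longrightarrow> x j \<otimes>\<^bsub>G\<^esub> x k = x k \<otimes>\<^bsub>G\<^esub> x j"
  shows "bar_boundary G n (alternating_chain n x) = 0"
proof (cases n)
  case 0
  then show ?thesis by (simp add: bar_boundary_def)
next
  case (Suc m)
  let ?L = "\<lambda>\<sigma>. map (x \<circ> \<sigma>) [0..<n]"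
  define S where "S = (\<lambda>i. \<Sum>\<sigma> | \<sigma> permutes {..<n}. frag_cmul (sign \<sigma>) (frag_of (bar_face G i (?L \<sigma>))))"
  have "bar_boundary G n (alternating_chain n x) = (\<Sum>\<sigma> | \<sigma> permutes {..<n}. \<Sum>i\<le>n.
      frag_cmul ((-1) ^ i) (frag_cmul (sign \<sigma>) (frag_of (bar_face G i (?L \<sigma>)))))"
    unfolding alternating_chain_def Suc bar_boundary_sum bar_boundary_cmul bar_boundary_of
    by (simp only: frag_cmul_sum frag_cmul_cmul mult.commute)
  also have "\<dots> = (\<Sum>i\<le>n. frag_cmul ((-1) ^ i) (S i))"
    unfolding S_def frag_cmul_sum by (rule sum.swap)
  also have "\<dots> = S 0 + (\<Sum>i=1..m. frag_cmul ((-1) ^ i) (S i)) + frag_cmul ((-1) ^ n) (S n)"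
  proof -
    have "{..n} = insert 0 (insert n {1..m})" using Suc by auto
    then show ?thesis using Suc by (simp add: add_ac)
  qed
  also have "(\<Sum>i=1..m. frag_cmul ((-1) ^ i) (S i)) = 0"
  proof (rule sum.neutral, rule ballI)
    fix i assume i: "i \<in> {1..m}"
    let ?\<tau> = "Transposition.transpose (i - 1) i"
    have \<tau>: "?\<tau> permutes {..<n}"
      by (rule permutes_swap_id) (use i Suc in auto)
    have face: "bar_face G i (?L (\<sigma> \<circ> ?\<tau>)) = bar_face G i (?L \<sigma>)" if "\<sigma> permutes {..<n}" for \<sigma>
    proof -
      have less: "\<sigma> k < n" if "k < n" for k
        using permutes_in_image[OF \<open>\<sigma> permutes {..<n}\<close>, of k] that by simp
      show ?thesis
      proof (rule nth_equalityI)
        fix k assume "k < length (bar_face G i (?L (\<sigma> \<circ> ?\<tau>)))"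
        then have "Suc k < n" using i Suc by (simp add: length_bar_face)
        then show "bar_face G i (?L (\<sigma> \<circ> ?\<tau>)) ! k = bar_face G i (?L \<sigma>) ! k"
          using i Suc comm[OF less less]
          by (auto simp: nth_bar_face Transposition.transpose_def simp del: upt_Suc)
      qed (use i Suc in \<open>simp add: length_bar_face del: upt_Suc\<close>)
    qed
    have "sign ?\<tau> = -1" using i by (auto simp: sign_swap_id)
    then have "S i = frag_cmul (-1) (\<Sum>\<sigma> | \<sigma> permutes {..<n}.
        frag_cmul (sign \<sigma>) (frag_of (bar_face G i (?L (\<sigma> \<circ> ?\<tau>)))))"
      unfolding S_def by (subst sum_sign_compose[OF _ \<tau>]) auto
    also have "\<dots> = - S i"
      unfolding S_def frag_cmul_minus_one
      by (intro arg_cong[of _ _ uminus] sum.cong refl) (simp only: face mem_Collect_eq)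
    finally have "S i + S i = 0" by (simp only: eq_neg_iff_add_eq_0)
    \<comment> \<open>A free abelian group has no 2-torsion.\<close>
    then have "frag_cmul 2 (S i) = 0"
      by (simp add: poly_mapping_eq_iff fun_eq_iff lookup_add)
    then show "frag_cmul ((-1) ^ i) (S i) = 0"
      by simp
  qed
  also have "S n = frag_cmul ((-1) ^ m) (S 0)"
  proof -
    obtain \<rho> where \<rho>: "\<rho> permutes {..<n}" "sign \<rho> = (-1) ^ m" "\<And>k. k < m \<Longrightarrow> \<rho> k = Suc k"
      using cyclic_permutation_exists[of m] Suc by auto
    have "bar_face G n (?L (\<sigma> \<circ> \<rho>)) = bar_face G 0 (?L \<sigma>)" for \<sigma>
      using Suc \<rho>(3)
      by (intro nth_equalityI) (auto simp: length_bar_face nth_bar_face simp del: upt_Suc)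
    then show ?thesis
      unfolding S_def by (subst sum_sign_compose[OF _ \<rho>(1)]) (auto simp: \<rho>(2))
  qed
  also have "S 0 + 0 + frag_cmul ((-1) ^ n) (frag_cmul ((-1) ^ m) (S 0)) = 0"
    by (simp add: Suc flip: power_mult_distrib)
  finally show ?thesis .
qed

text \<open>A permutation that moves some \<open>j\<close> contributes the zero factor
  \<open>\<phi> j (x (\<sigma> j))\<close>; only the identity survives.\<close>

lemma frag_eval_cup_hom_alternating_chain:
  fixes \<phi> :: "nat \<Rightarrow> 'a \<Rightarrow> 'r::comm_ring_1"
  assumes dual: "\<And>j k. j < n \<Longrightarrow> k < n \<Longrightarrow> \<phi> j (x k) = (if j = k then 1 else 0)"
  shows "frag_eval (cup_hom \<phi>) (alternating_chain n x) = 1"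
proof -
  have cup: "cup_hom \<phi> (map (x \<circ> \<sigma>) [0..<n]) = (if \<sigma> = id then 1 else 0)"
    if \<sigma>: "\<sigma> permutes {..<n}" for \<sigma>
  proof (cases "\<sigma> = id")
    case True
    then show ?thesis by (simp add: cup_hom_def dual)
  next
    case False
    then obtain j where j: "\<sigma> j \<noteq> j" by (auto simp: fun_eq_iff)
    then have "j < n" using permutes_not_in[OF \<sigma>, of j] by auto
    moreover have "\<sigma> j < n" using permutes_in_image[OF \<sigma>, of j] \<open>j < n\<close> by simp
    ultimately have "\<phi> j (x (\<sigma> j)) = 0" using dual[of j "\<sigma> j"] j by simp
    then show ?thesis
      using \<open>j < n\<close> False by (auto simp: cup_hom_def intro!: prod_zero bexI[of _ j])
  qed
  have "frag_eval (cup_hom \<phi>) (alternating_chain n x) =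
      (\<Sum>\<sigma> | \<sigma> permutes {..<n}. if \<sigma> = id then 1 else 0)"
    unfolding alternating_chain_def frag_eval_sum frag_eval_cmul frag_eval_of
    by (intro sum.cong refl) (auto simp: cup)
  also have "\<dots> = 1"
    by (subst sum.delta) (auto simp: finite_permutations permutes_id)
  finally show ?thesis .
qed


section \<open>Homomorphisms from \<open>SL\<^sub>2(\<F>\<^sub>2[t])\<close> to \<open>\<F>\<^sub>2\<close>\<close>

lemma bit_poly_add_self [simp]: "p + p = (0 :: bit poly)" "p + (p + q) = (q :: bit poly)"
proof -
  show *: "p + p = 0" for p :: "bit poly" by (rule poly_eqI) (simp only: coeff_add, simp)
  show "p + (p + q) = q" by (simp add: * flip: add.assoc)
qed

lemma bit_poly_minus [simp]: "- p = (p :: bit poly)" "p - q = p + (q :: bit poly)"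
proof -
  show *: "- p = p" for p :: "bit poly" by (rule poly_eqI) simp
  show "p - q = p + q" using *[of q] by (metis diff_conv_add_uminus)
qed

lemma bit_poly_degree_0: "degree p = 0 \<Longrightarrow> p \<noteq> 0 \<Longrightarrow> p = (1 :: bit poly)"
  by (metis bit_not_zero_iff degree_eq_zeroE one_pCons pCons_0_0)

text \<open>F_2[t] has no unit except 1, so triangular matrices of determinant 1 have unit
  diagonal.\<close>

lemma bit_poly_mult_eq_1:
  fixes p q :: "bit poly"
  assumes pq: "p * q = 1"
  shows "p = 1 \<and> q = 1"
proof -
  have "p \<noteq> 0" "q \<noteq> 0" using pq by auto
  then have "degree p + degree q = 0"
    using degree_mult_eq[of p q] pq by simp
  then show ?thesis
    using bit_poly_degree_0 \<open>p \<noteq> 0\<close> \<open>q \<noteq> 0\<close> by simp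
qed

section \<open>Sums of Euclidean quotients\<close>

function quotient_sum :: "bit poly \<Rightarrow> bit poly \<Rightarrow> bit poly" where
  "quotient_sum a c = (if c = 0 then 0 else a div c + quotient_sum c (a mod c))"
  by auto
termination
  by (relation "measure (\<lambda>(a, c). euclidean_size c)") (auto simp: mod_size_less)

declare quotient_sum.simps [simp del]

lemma quotient_sum_0 [simp]: "quotient_sum a 0 = 0"
  by (simp add: quotient_sum.simps)

lemma quotient_sum_add_mult:
  "c \<noteq> 0 \<Longrightarrow> quotient_sum (a + x * c) c = x + quotient_sum a c"
  by (simp add: quotient_sum.simps[of _ c] algebra_simps)

lemma poly_div_mod_unique:
  fixes a b q r :: "'a::field poly"
  assumes "b = q * a + r" "a \<noteq> 0" "r = 0 \<or> degree r < degree a"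
  shows "b div a = q" "b mod a = r"
proof -
  have "r div a = 0" using assms(3) by (auto simp: div_poly_eq_0_iff)
  then show "b div a = q" "b mod a = r"
    using assms by (simp_all add: mod_eq_self_iff_div_eq_0)
qed

text \<open>For unequal degrees one of the two runs only has an extra first quotient 0. For equal
  degrees both first quotients are 1 with the same remainder, and the sums differ at most by a
  constant.\<close>

lemma coeff_quotient_sum_swap:
  assumes "a \<noteq> 0" "c \<noteq> 0" "n > 0"
  shows "coeff (quotient_sum a c) n = coeff (quotient_sum c a) n"
proof -
  consider "degree a < degree c" | "degree c < degree a" | "degree a = degree c" by linarith
  then show ?thesis
  proof cases
    case 1
    then show ?thesis
      using assms quotient_sum.simps[of a c] by (simp add: div_poly_less mod_poly_less)
  next
    case 2
    then show ?thesis
      using assms quotient_sum.simps[of c a] by (simp add: div_poly_less mod_poly_less)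
  next
    case 3
    define r where "r = a + c"
    have a: "a = 1 * c + r" and c: "c = 1 * a + r"
      by (simp_all add: r_def add_ac)
    have r: "r = 0 \<or> degree r < degree c"
    proof -
      have "coeff r (degree c) = 0"
        using assms 3 by (simp add: r_def) (metis bit_not_zero_iff leading_coeff_0_iff)
      moreover have "degree r \<le> degree c"
        using 3 degree_add_le[of a "degree c" c] by (simp add: r_def)
      ultimately show ?thesis
        by (metis le_neq_implies_less leading_coeff_0_iff)
    qed
    have "a div c = 1" "a mod c = r" "c div a = 1" "c mod a = r"
      using poly_div_mod_unique[OF a] poly_div_mod_unique[OF c] r assms 3 by auto
    then have "quotient_sum a c = 1 + quotient_sum c r" "quotient_sum c a = 1 + quotient_sum a r"
      using assms by (simp_all add: quotient_sum.simps[of a c] quotient_sum.simps[of c a])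
    moreover have "quotient_sum a r = (if r = 0 then 0 else 1) + quotient_sum c r"
      using a quotient_sum_add_mult[of r c 1] by (auto simp: add_ac)
    ultimately show ?thesis using assms(3) by simp
  qed
qed

text \<open>The fractions d/c and b/a differ by 1/(ac), which has no polynomial part unless a = c =
  1; then the quotients differ by the constant 1.\<close>

lemma coeff_div_eq:
  fixes a b c d :: "bit poly"
  assumes "a \<noteq> 0" "c \<noteq> 0" "n > 0" and det: "a * d + b * c = 1"
  shows "coeff (d div c) n = coeff (b div a) n"
proof (cases "degree a + degree c = 0")
  case True
  then have "a = 1" "c = 1" using assms bit_poly_degree_0 by auto
  then have "d = 1 + b" using det
    by (metis add.commute add.left_commute bit_poly_add_self(2) mult_1 mult.commute)
  then show ?thesis using \<open>a = 1\<close> \<open>c = 1\<close> \<open>n > 0\<close> by simp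
next
  case False
  define q s where "q = d div c" and "s = d mod c"
  have d: "d = q * c + s" by (simp add: q_def s_def)
  have s: "s = 0 \<or> degree s < degree c"
    unfolding s_def using degree_mod_less[OF \<open>c \<noteq> 0\<close>] by blast
  \<comment> \<open>The expected remainder of \<open>b\<close> modulo \<open>a\<close>; the identity
    for \<open>e * c\<close> bounds its degree.\<close>
  define e where "e = b + q * a"
  have ec: "e * c = a * s + 1"
  proof -
    have "a * s + (a * d + b * c) = e * c"
      by (simp add: d e_def algebra_simps)
    then show ?thesis by (simp add: det)
  qed
  have "e = 0 \<or> degree e < degree a"
  proof (cases "e = 0")
    case e: False
    have "degree (a * s + 1) < degree a + degree c"
    proof (cases "s = 0")
      case True
      then show ?thesis using False by simp
    next
      case s0: False
      have "degree (a * s) < degree a + degree c"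
        using s s0 \<open>a \<noteq> 0\<close> by (simp add: degree_mult_eq)
      then show ?thesis
        using False by (intro degree_add_less) auto
    qed
    then show ?thesis
      using e \<open>c \<noteq> 0\<close> by (simp flip: ec add: degree_mult_eq)
  qed simp
  moreover have "b = q * a + e" by (simp add: e_def add_ac)
  ultimately have "b div a = q"
    using \<open>a \<noteq> 0\<close> by (intro poly_div_mod_unique(1))
  then show ?thesis by (simp add: q_def)
qed

section \<open>Additivity of the continued fraction sum in positive degrees\<close>

text \<open>
  Writing \<open>A = u(q\<^sub>1) w u(q\<^sub>2) w \<dots> u(q\<^sub>k) w u(s)\<close> with \<open>u(x)\<close> upper unipotent and \<open>w\<close> the swap, the
  \<open>q\<^sub>i\<close> are the Euclidean quotients of the first column, \<open>s\<close> is the polynomial part of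
  \<open>A\<^sub>2\<^sub>2 / A\<^sub>2\<^sub>1\<close>, and the value is \<open>q\<^sub>1 + \<dots> + q\<^sub>k + s\<close>. It is additive only modulo constants.
\<close>

definition continued_fraction_sum :: "bit poly ^ 2 ^ 2 \<Rightarrow> bit poly"
  where "continued_fraction_sum A = quotient_sum (A $ 1 $ 1) (A $ 2 $ 1) +
    (if A $ 2 $ 1 = 0 then A $ 1 $ 2 else A $ 2 $ 2 div A $ 2 $ 1)"

text \<open>Its determinant is -1, so it belongs to SL_2 in characteristic 2.\<close>

definition swap_matrix :: "'a::comm_ring_1 ^ 2 ^ 2"
  where "swap_matrix = (\<chi> i j. if i = j then 0 else 1)"

lemma matrix_mult_nth_2:
  "(A ** B) $ i $ j = A $ i $ 1 * B $ 1 $ j + A $ i $ 2 * (B :: 'a::comm_ring_1 ^ 'n ^ 2) $ 2 $ j"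
  by (simp add: matrix_matrix_mult_def sum_2)

lemma elementary_matrix_12_mult_nth:
  "(elementary_matrix 1 2 x ** A) $ 1 $ j = A $ 1 $ j + x * A $ 2 $ j"
  "(elementary_matrix 1 2 x ** A) $ 2 $ j = A $ 2 $ j"
  by (simp_all add: matrix_mult_nth_2 elementary_matrix_def)

lemma swap_matrix_mult_nth:
  "(swap_matrix ** A) $ 1 $ j = A $ 2 $ j" "(swap_matrix ** A) $ 2 $ j = A $ 1 $ j"
  by (simp_all add: matrix_mult_nth_2 swap_matrix_def)

text \<open>Only the first Euclidean quotient changes, or the upper right entry when the lower left
  one is 0.\<close>

lemma continued_fraction_sum_elementary_mult:
  assumes "det A = 1"
  shows "continued_fraction_sum (elementary_matrix 1 2 x ** A) = x + continued_fraction_sum A"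
proof (cases "A $ 2 $ 1 = 0")
  case True
  then have "A $ 2 $ 2 = 1"
    using assms bit_poly_mult_eq_1[of "A $ 1 $ 1" "A $ 2 $ 2"] by (simp add: det_2)
  with True show ?thesis
    by (simp add: continued_fraction_sum_def elementary_matrix_12_mult_nth add_ac)
next
  case False
  then show ?thesis
    by (simp add: continued_fraction_sum_def elementary_matrix_12_mult_nth quotient_sum_add_mult
        add_ac)
qed

lemma coeff_continued_fraction_sum_swap_mult:
  assumes "det A = 1" "n > 0"
  shows "coeff (continued_fraction_sum (swap_matrix ** A)) n = coeff (continued_fraction_sum A) n"
proof -
  obtain a b c d where A: "a = A $ 1 $ 1" "b = A $ 1 $ 2" "c = A $ 2 $ 1" "d = A $ 2 $ 2"
    by blast
  have det: "a * d + b * c = 1" using assms(1) by (simp add: det_2 A)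
  have q01: "quotient_sum 0 1 = 0" by (simp add: quotient_sum.simps)
  consider "a = 0" | "c = 0" | "a \<noteq> 0" "c \<noteq> 0" by blast
  then show ?thesis
  proof cases
    case 1
    then have "b = 1" "c = 1" using det bit_poly_mult_eq_1[of b c] by auto
    then show ?thesis
      using 1 by (simp add: q01 continued_fraction_sum_def swap_matrix_mult_nth flip: A)
  next
    case 2
    then have "a = 1" "d = 1" using det bit_poly_mult_eq_1[of a d] by auto
    then show ?thesis
      using 2 by (simp add: q01 continued_fraction_sum_def swap_matrix_mult_nth flip: A)
  next
    case 3
    then show ?thesis
      using coeff_quotient_sum_swap[OF 3 assms(2)] coeff_div_eq[OF 3 assms(2) det]
      by (simp add: continued_fraction_sum_def swap_matrix_mult_nth flip: A)
  qed
qed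

text \<open>The Euclidean algorithm on the first column: unipotents and the swap generate
  SL_2(F_2[t]).\<close>

lemma SL2_bit_poly_induct [consumes 1, case_names one elementary swap]:
  fixes B :: "bit poly ^ 2 ^ 2"
  assumes "det B = 1" "P (mat 1)"
    and elementary: "\<And>x A. det A = 1 \<Longrightarrow> P A \<Longrightarrow> P (elementary_matrix 1 2 x ** A)"
    and swap: "\<And>A. det A = 1 \<Longrightarrow> P A \<Longrightarrow> P (swap_matrix ** A)"
  shows "P B"
  using assms(1)
proof (induction "euclidean_size (B $ 2 $ 1)" arbitrary: B rule: less_induct)
  case less
  show ?case
  proof (cases "B $ 2 $ 1 = 0")
    case True
    then have "B $ 1 $ 1 = 1" "B $ 2 $ 2 = 1"
      using less.prems bit_poly_mult_eq_1[of "B $ 1 $ 1" "B $ 2 $ 2"] by (auto simp: det_2)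
    then have "B = elementary_matrix 1 2 (B $ 1 $ 2) ** mat 1"
      using True by (simp add: vec_eq_iff forall_2 elementary_matrix_def)
    then show ?thesis using elementary[of "mat 1"] assms(2) by (metis det_I)
  next
    case False
    \<comment> \<open>One division step turns the first column (a, c) into (c, a mod c). It is
      undone by the same two matrices, which are involutions in characteristic 2.\<close>
    define q where "q = B $ 1 $ 1 div B $ 2 $ 1"
    define C where "C = swap_matrix ** (elementary_matrix 1 2 q ** B)"
    have C: "C $ 1 $ j = B $ 2 $ j" "C $ 2 $ j = B $ 1 $ j + q * B $ 2 $ j" for j
      by (simp_all add: C_def swap_matrix_mult_nth elementary_matrix_12_mult_nth)
    have "C $ 2 $ 1 = B $ 1 $ 1 mod B $ 2 $ 1"
      using minus_div_mult_eq_mod[of "B $ 1 $ 1" "B $ 2 $ 1"] by (simp add: C q_def)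
    moreover have "det C = 1"
      using less.prems by (simp add: det_2 C algebra_simps)
    ultimately have "P C"
      using less.hyps[of C] False by (simp add: mod_size_less)
    moreover have "B = elementary_matrix 1 2 q ** (swap_matrix ** C)"
      by (simp add: vec_eq_iff forall_2 elementary_matrix_12_mult_nth swap_matrix_mult_nth C algebra_simps)
    moreover have "det (swap_matrix ** C) = 1"
      using \<open>det C = 1\<close> by (simp add: det_2 swap_matrix_mult_nth add.commute mult.commute)
    ultimately show ?thesis
      using \<open>det C = 1\<close> elementary swap by metis
  qed
qed

text \<open>Multiplying on the left by a generator changes both sides equally, so induction on the
  left factor suffices.\<close>

lemma coeff_continued_fraction_sum_mult:
  assumes "det A = 1" "det B = 1" "n > 0"
  shows "coeff (continued_fraction_sum (B ** A)) n =
    coeff (continued_fraction_sum B) n + coeff (continued_fraction_sum A) n"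
  using assms(2)
proof (induction B rule: SL2_bit_poly_induct)
  case one
  have "continued_fraction_sum (mat 1) = 0" by (simp add: continued_fraction_sum_def mat_def)
  then show ?case by simp
next
  case (elementary x C)
  have "det (C ** A) = 1" using assms elementary by (simp add: det_mul)
  then show ?case
    using elementary by (simp add: continued_fraction_sum_elementary_mult add.assoc
        flip: matrix_mul_assoc del: add_bit_eq_xor)
next
  case (swap C)
  have "det (C ** A) = 1" using assms swap by (simp add: det_mul)
  then show ?case
    using swap assms(3) by (simp add: coeff_continued_fraction_sum_swap_mult flip: matrix_mul_assoc)
qed

section \<open>Reduction modulo 2 and the dual homomorphisms\<close>

definition mod2_matrix :: "int poly ^ 2 ^ 2 \<Rightarrow> bit poly ^ 2 ^ 2"
  where "mod2_matrix A = (\<chi> i j. map_poly of_int (A $ i $ j))"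

lemma map_poly_of_int_ring_hom:
  "map_poly of_int (p + q) = (map_poly of_int p + map_poly of_int q :: 'a::comm_ring_1 poly)"
  "map_poly of_int (p - q) = (map_poly of_int p - map_poly of_int q :: 'a poly)"
  "map_poly of_int (p * q) = (map_poly of_int p * map_poly of_int q :: 'a poly)"
  by (auto intro!: poly_eqI simp: coeff_map_poly coeff_mult)

lemma mod2_matrix_mult: "mod2_matrix (A ** B) = mod2_matrix A ** mod2_matrix B"
  by (simp add: mod2_matrix_def vec_eq_iff matrix_mult_nth_2 map_poly_of_int_ring_hom)

lemma det_mod2_matrix: "det (mod2_matrix A) = map_poly of_int (det A)"
  unfolding det_2 mod2_matrix_def map_poly_of_int_ring_hom by simp

definition SL2_hom :: "nat \<Rightarrow> int poly ^ 2 ^ 2 \<Rightarrow> bit"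
  where "SL2_hom j A = coeff (continued_fraction_sum (mod2_matrix A)) (Suc j)"

lemma SL2_hom_mult:
  assumes "A \<in> carrier SL2" "B \<in> carrier SL2"
  shows "SL2_hom j (A \<otimes>\<^bsub>SL2\<^esub> B) = SL2_hom j A + SL2_hom j B"
proof -
  have "det (mod2_matrix A) = 1" "det (mod2_matrix B) = 1"
    using assms by (simp_all add: SL2_def det_mod2_matrix)
  then show ?thesis
    by (simp add: SL2_def GL2_def SL2_hom_def mod2_matrix_mult coeff_continued_fraction_sum_mult)
qed

text \<open>When the lower left entry is 0, \<open>continued_fraction_sum\<close> reads off the
  upper right entry.\<close>

lemma SL2_hom_elementary_matrix:
  "SL2_hom j (elementary_matrix 1 2 (monom 1 (Suc k))) = (if j = k then 1 else 0)"
proof -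
  have "continued_fraction_sum (mod2_matrix (elementary_matrix 1 2 p)) = map_poly of_int p" for p
    by (simp add: continued_fraction_sum_def mod2_matrix_def elementary_matrix_def)
  then show ?thesis
    by (auto simp: SL2_hom_def coeff_map_poly)
qed

section \<open>Nontriviality in homology\<close>

theorem theoremB:
  fixes i :: nat
  shows "\<exists>x \<in> carrier (group_homology i (E2 :: (int poly ^ 2 ^ 2) monoid)).
           group_homology_map i E2 (SL2 :: (int poly ^ 2 ^ 2) monoid) id x
             \<noteq> \<one>\<^bsub>group_homology i (SL2 :: (int poly ^ 2 ^ 2) monoid)\<^esub>"
proof -
  let ?E = "E2 :: (int poly ^ 2 ^ 2) monoid" and ?S = "SL2 :: (int poly ^ 2 ^ 2) monoid"
  define x :: "nat \<Rightarrow> int poly ^ 2 ^ 2" where "x k = elementary_matrix 1 2 (monom 1 (Suc k))" for k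
  define z where "z = alternating_chain i x"
  interpret E: group ?E by (rule group_E2)
  interpret S: group ?S by (rule group_SL2)
  have "x k \<in> carrier ?E" for k
  proof -
    have "x k \<in> carrier GL2"
      using elementary_matrix_in_SL2[of 1 2 "monom 1 (Suc k) :: int poly"] by (simp add: x_def SL2_def)
    then show ?thesis
      unfolding E2_def carrier_subgroup_generated
      by (intro generate.incl) (force simp: x_def)
  qed
  moreover have "x j \<otimes>\<^bsub>?E\<^esub> x k = x k \<otimes>\<^bsub>?E\<^esub> x j" for j k
    by (simp add: E2_def GL2_def x_def elementary_matrix_mult add.commute)
  ultimately have z: "z \<in> carrier (bar_cycles ?E i)"
    by (simp add: z_def keys_alternating_chain bar_boundary_alternating_chain)
  let ?X = "bar_boundaries ?E i #>\<^bsub>bar_cycles ?E i\<^esub> z"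
  have "bar_map id c = c" for c :: "(int poly ^ 2 ^ 2) list \<Rightarrow>\<^sub>0 int"
    by (simp add: bar_map_def flip: frag_expansion)
  then have map: "group_homology_map i ?E ?S id ?X = bar_boundaries ?S i #>\<^bsub>bar_cycles ?S i\<^esub> z"
    using group_homology_map_class[OF E.is_monoid S.is_monoid id_hom_E2_SL2 z] by simp
  have "frag_eval (cup_hom SL2_hom) z = 1"
    unfolding z_def x_def
    by (rule frag_eval_cup_hom_alternating_chain) (rule SL2_hom_elementary_matrix)
  then have "z \<notin> bar_boundaries ?S i"
    using frag_eval_cup_hom_boundaries[of ?S SL2_hom z i] SL2_hom_mult by auto
  \<comment> \<open>A coset contains its representative, so a neutral class would make
    \<open>z\<close> a boundary.\<close>
  moreover have "z \<in> bar_boundaries ?S i #>\<^bsub>bar_cycles ?S i\<^esub> z"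
    using subgroup.one_closed[OF subgroup_bar_boundaries[OF S.is_monoid, of i]]
    by (force simp: r_coset_def)
  ultimately have "group_homology_map i ?E ?S id ?X \<noteq> \<one>\<^bsub>group_homology i ?S\<^esub>"
    using map by (auto simp: group_homology_def FactGroup_def)
  moreover have "?X \<in> carrier (group_homology i ?E)"
    using z by (auto simp: group_homology_def carrier_FactGroup simp del: carrier_bar_cycles)
  ultimately show ?thesis by blast
qed

end
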